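(* Let $M_1$ and $M_2$ be two adjacent perfect matchings of the complete graph $K_{2n}$ and let $M_3$ be a third perfect matching of $K_{2n}$. Then the three matchings $M_1,M_2,M_3$ are pairwise adjacent, or there exists a perfect matching $M'$ of $K_{2n}$ adjacent to all three.
   Context: Two perfect matchings $M,M'$ of $K_{2n}$ are called adjacent if the corresponding vertices (their characteristic vectors) are adjacent, i.e. joined by an edge, in the perfect matching polytope of $K_{2n}$ (the convex hull of characteristic vectors of all perfect matchings). By a theorem of Chvátal this is equivalent to the symmetric difference $M\Delta M'$ forming a single alternating cycle. *)

theory Defs
  imports "HOL-Analysis.Analysis"
begin

text \<open>
  The vertex set of the complete graph is a finite type \<open>'v\<close>; an edge is a two-element
  set of vertices.
\<close>

definition complete_edges :: "'v::finite set set" where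
  "complete_edges = {e. card e = 2}"

definition perfect_matching :: "'v::finite set set \<Rightarrow> bool" where
  "perfect_matching M \<longleftrightarrow> M \<subseteq> complete_edges \<and> (\<forall>v. \<exists>!e. e \<in> M \<and> v \<in> e)"

text \<open>
  Characteristic vectors live in the space with one coordinate for every set of vertices, since
  the edges alone do not form a type. For \<open>M \<subseteq> complete_edges\<close> all coordinates other than those
  indexed by edges vanish, so this is the usual vector under the coordinate embedding of the
  space indexed by the edges; the faces of a polytope do not depend on the ambient space.
\<close>

definition char_vec :: "'v::finite set set \<Rightarrow> real ^ ('v set)" where
  "char_vec M = (\<chi> e. if e \<in> M then 1 else 0)"

definition perfect_matching_polytope :: "(real ^ ('v::finite set)) set" where
  "perfect_matching_polytope = convex hull (char_vec ` {M. perfect_matching M})"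

text \<open>
  Since an edge has affine dimension 1, adjacency is irreflexive.
\<close>

definition adjacent_matchings :: "'v::finite set set \<Rightarrow> 'v set set \<Rightarrow> bool" where
  "adjacent_matchings M M' \<longleftrightarrow>
     perfect_matching M \<and> perfect_matching M' \<and>
     closed_segment (char_vec M) (char_vec M') edge_of perfect_matching_polytope"

end

theory Submission
  imports Defs
begin

text \<open>
  Adjacency is obtained from alternating cycles: if the symmetric difference of two perfect
  matchings \<open>M\<close>, \<open>M'\<close> is a single alternating cycle, then they are adjacent. Indeed the
  polytope meets the supporting hyperplane \<open>(\<Sum>e \<notin> M \<union> M'. x\<^sub>e) = 0\<close> in a face whose vertices
  are the perfect matchings contained in \<open>M \<union> M'\<close>, and these are just \<open>M\<close> and \<open>M'\<close>
  (\<open>adjacent_if_alternating_cycle\<close>). The rest is combinatorics of three matchings \<open>a\<close>, \<open>b\<close>, \<open>c\<close>.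

  Let \<open>V\<close> be the set of vertices at which the three matchings do not all use the same edge. If
  \<open>card V < 8\<close>, then any two distinct ones among the matchings differ in a single cycle, since two
  disjoint alternating cycles need four vertices each; so the three are pairwise adjacent. If
  \<open>card V \<ge> 8\<close>, there is a matching \<open>g\<close> of \<open>V\<close> whose union with each of \<open>a\<close>, \<open>b\<close>, \<open>c\<close> is a
  Hamiltonian cycle of \<open>V\<close> (\<open>hamiltonian_mate_three\<close>). Extended by the common edges outside \<open>V\<close>,
  it is the required \<open>M'\<close>.

  To find \<open>g\<close>, decide that it contains some pair \<open>{u, v}\<close> joined by none of the three matchings.
  Deleting \<open>u\<close> and \<open>v\<close> and joining, in each matching, the two vertices that lose their partners
  gives three matchings of \<open>V - {u, v}\<close>, and a partner \<open>g\<close> for them extends by \<open>{u, v}\<close>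
  (\<open>hamiltonian_mate_uncontract\<close>). Such contractions must not end in a triple
  without a common partner, such as the three matchings of \<open>K\<^sub>4\<close> or three matchings that
  decompose \<open>K\<^sub>3\<^sub>,\<^sub>3\<close>, possibly with edges common to all three added. In both, every edge
  lies in exactly one or in all three of the matchings. An edge that lies in exactly two of them
  keeps away from these obstructions, and it can be preserved until two of the matchings coincide
  (\<open>hamiltonian_mate_if_doubly_covered_edge\<close>).

  There remains the case that the three matchings are pairwise disjoint. Then one contraction should
  create a doubly covered edge. Contracting the two ends of a path with edges in \<open>a\<close>, \<open>b\<close>, \<open>a\<close>
  does so, unless the ends are joined or the four vertices of the path span all but one edge of
  their \<open>K\<^sub>4\<close>. So does contracting two opposite vertices of a 4-cycle with edges in \<open>a\<close>, \<open>b\<close>,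
  \<open>a\<close>, \<open>b\<close>, unless \<open>c\<close> contains one of its diagonals. When both fail for every choice of path
  or cycle and of the roles of the three matchings, the cubic graph formed by the three
  matchings has a component \<open>K\<^sub>4\<close> or \<open>K\<^sub>3\<^sub>,\<^sub>3\<close>. As \<open>V\<close> is larger than that, the graph is
  disconnected, and contracting two vertices of different components brings the path argument
  back into play (\<open>hamiltonian_mate_if_disconnected\<close>).
\<close>

section \<open>Matchings as involutions\<close>

text \<open>
  A perfect matching of \<open>V\<close> is encoded by the map that sends a vertex to its partner. Values outside
  \<open>V\<close> are left arbitrary, so that a map can be restricted to a smaller invariant set or contracted
  without being redefined elsewhere.
\<close>
definition matching_on :: "'a set \<Rightarrow> ('a \<Rightarrow> 'a) \<Rightarrow> bool" where
  "matching_on V f \<longleftrightarrow> (\<forall>x\<in>V. f x \<in> V \<and> f x \<noteq> x \<and> f (f x) = x)"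

text \<open>
  The union of two matchings is a disjoint union of alternating cycles, where an edge in both counts
  as a cycle of length two. It is one Hamiltonian cycle exactly if it is connected, that is, if no
  proper nonempty vertex set is closed under both partner maps.
\<close>
definition hamiltonian :: "'a set \<Rightarrow> ('a \<Rightarrow> 'a) \<Rightarrow> ('a \<Rightarrow> 'a) \<Rightarrow> bool" where
  "hamiltonian V f g \<longleftrightarrow>
     (\<forall>S\<subseteq>V. S \<noteq> {} \<longrightarrow> f ` S \<subseteq> S \<longrightarrow> g ` S \<subseteq> S \<longrightarrow> S = V)"

definition hamiltonian_mate :: "'a set \<Rightarrow> ('a \<Rightarrow> 'a) set \<Rightarrow> bool" where
  "hamiltonian_mate V F \<longleftrightarrow> (\<exists>g. matching_on V g \<and> (\<forall>f\<in>F. hamiltonian V f g))"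

text \<open>
  The matching that remains after \<open>u\<close> and \<open>v\<close> are deleted and their former partners are joined. It
  is meaningful on \<open>V - {u, v}\<close> when \<open>u\<close> and \<open>v\<close> are not partners themselves.
\<close>
definition contract :: "'a \<Rightarrow> 'a \<Rightarrow> ('a \<Rightarrow> 'a) \<Rightarrow> 'a \<Rightarrow> 'a" where
  "contract u v f x = (if f x = u then f v else if f x = v then f u else f x)"

lemma matching_onD:
  assumes "matching_on V f" "x \<in> V"
  shows "f x \<in> V" "f x \<noteq> x" "x \<noteq> f x" "f (f x) = x"
  using assms unfolding matching_on_def by metis+

lemma matching_on_contract:
  assumes "matching_on V f" "u \<in> V" "v \<in> V" "u \<noteq> v" "f u \<noteq> v"
  shows "matching_on (V - {u, v}) (contract u v f)"
  unfolding matching_on_def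
proof (intro ballI)
  note D = matching_onD[OF assms(1)]
  fix x assume x: "x \<in> V - {u, v}"
  have uv: "f u \<in> V" "f u \<noteq> u" "f (f u) = u" "f v \<in> V" "f v \<noteq> v" "f (f v) = v" "f v \<noteq> u"
    using D[OF assms(2)] D[OF assms(3)] assms(5) by auto
  have fx: "f x \<in> V" "f x \<noteq> x" "f (f x) = x" using D[of x] x by auto
  show "contract u v f x \<in> V - {u, v} \<and> contract u v f x \<noteq> x \<and>
    contract u v f (contract u v f x) = x"
  proof (cases "f x = u \<or> f x = v")
    case True
    then consider "f x = u" "x = f u" | "f x = v" "x = f v" using fx by metis
    then show ?thesis
      using uv x assms(4,5) by cases (auto simp: contract_def dest: arg_cong[of _ _ f])
  next
    case False
    then show ?thesis using fx x by (auto simp: contract_def)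
  qed
qed

text \<open>
  Undoing the contraction replaces the edge between \<open>f u\<close> and \<open>f v\<close> of the cycle by the path
  \<open>f u\<close>, \<open>u\<close>, \<open>v\<close>, \<open>f v\<close>, which leaves a single cycle. In terms of closed sets: removing \<open>u\<close> and
  \<open>v\<close> from a closed set of the large cycle gives a closed set of the small one.
\<close>
lemma hamiltonian_uncontract:
  assumes f: "matching_on V f" and g: "matching_on (V - {u, v}) g"
    and uv: "u \<in> V" "v \<in> V" "u \<noteq> v" "f u \<noteq> v"
    and ham: "hamiltonian (V - {u, v}) (contract u v f) g"
  shows "hamiltonian V f (g(u := v, v := u))"
  unfolding hamiltonian_def
proof (intro allI impI)
  let ?g = "g(u := v, v := u)"
  fix S assume S: "S \<subseteq> V" "S \<noteq> {}" "f ` S \<subseteq> S" "?g ` S \<subseteq> S"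
  have fS: "f x \<in> S" if "x \<in> S" for x using S that by blast
  have gS: "?g x \<in> S" if "x \<in> S" for x using S(4) that by blast
  have uvS: "u \<in> S \<longleftrightarrow> v \<in> S" using gS[of u] gS[of v] uv by auto
  let ?S = "S - {u, v}"
  have fu: "f u \<in> V - {u, v}" using matching_onD[OF f uv(1)] uv by auto
  have c: "contract u v f ` ?S \<subseteq> ?S"
  proof
    fix y assume "y \<in> contract u v f ` ?S"
    then obtain x where x: "x \<in> S" "x \<noteq> u" "x \<noteq> v" "y = contract u v f x" by auto
    have "y \<in> V - {u, v}"
      using matching_onD(1)[OF matching_on_contract[OF f uv], of x] x S(1) by auto
    moreover have "y \<in> S"
    proof -
      consider "f x = u" "y = f v" | "f x = v" "y = f u" | "y = f x"
        using x(4) unfolding contract_def by metis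
      then show ?thesis using fS[OF x(1)] fS[of u] fS[of v] uvS by cases metis+
    qed
    ultimately show "y \<in> ?S" by auto
  qed
  have g': "g ` ?S \<subseteq> ?S"
  proof
    fix y assume "y \<in> g ` ?S"
    then obtain x where x: "x \<in> S" "x \<noteq> u" "x \<noteq> v" "y = g x" by auto
    then show "y \<in> ?S" using gS[of x] matching_onD(1)[OF g, of x] S(1) by auto
  qed
  show "S = V"
  proof (cases "?S = {}")
    case True
    then have "u \<in> S" using S(2) uvS by auto
    then show ?thesis using fS[of u] fu True by auto
  next
    case False
    then have eq: "?S = V - {u, v}"
      using ham c g' S(1) unfolding hamiltonian_def by (metis Diff_mono order_refl)
    then have "f (f u) \<in> S" using fu fS[of "f u"] by blast
    then have "u \<in> S" using matching_onD(4)[OF f uv(1)] by simp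
    then show ?thesis using uvS eq S(1) uv by blast
  qed
qed

lemma hamiltonian_mate_uncontract:
  assumes "u \<in> V" "v \<in> V" "u \<noteq> v"
    and F: "\<And>f. f \<in> F \<Longrightarrow> matching_on V f \<and> f u \<noteq> v"
    and mate: "hamiltonian_mate (V - {u, v}) (contract u v ` F)"
  shows "hamiltonian_mate V F"
proof -
  obtain g where g: "matching_on (V - {u, v}) g"
    "\<And>f. f \<in> F \<Longrightarrow> hamiltonian (V - {u, v}) (contract u v f) g"
    using mate unfolding hamiltonian_mate_def by auto
  have "matching_on V (g(u := v, v := u))"
    unfolding matching_on_def
  proof
    fix x assume x: "x \<in> V"
    let ?g = "g(u := v, v := u)"
    show "?g x \<in> V \<and> ?g x \<noteq> x \<and> ?g (?g x) = x"
      using matching_onD[OF g(1), of x] x assms(1-3) by (cases "x \<in> {u, v}") auto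
  qed
  then show ?thesis
    using hamiltonian_uncontract[OF _ g(1) assms(1-3)] F g(2) unfolding hamiltonian_mate_def by metis
qed

text \<open>
  Besides changing maps outside \<open>V\<close>, this rule serves to merge matchings that agree on \<open>V\<close>.
\<close>
lemma hamiltonian_mate_cong:
  assumes "hamiltonian_mate V F" and "\<And>f. f \<in> F' \<Longrightarrow> \<exists>h\<in>F. \<forall>x\<in>V. f x = h x"
  shows "hamiltonian_mate V F'"
proof -
  obtain g where g: "matching_on V g" "\<And>f. f \<in> F \<Longrightarrow> hamiltonian V f g"
    using assms(1) unfolding hamiltonian_mate_def by auto
  have "hamiltonian V f g" if f: "f \<in> F'" for f
  proof -
    obtain h where h: "h \<in> F" "\<forall>x\<in>V. f x = h x" using assms(2) f by blast
    have "f ` S = h ` S" if "S \<subseteq> V" for S using h(2) that by (intro image_cong) auto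
    then show ?thesis using g(2)[OF h(1)] unfolding hamiltonian_def by auto
  qed
  then show ?thesis using g(1) unfolding hamiltonian_mate_def by auto
qed

section \<open>Common Hamiltonian partners\<close>

lemma ex_not_in_list:
  assumes "finite V" "length xs < card V"
  shows "\<exists>v\<in>V. v \<notin> set xs"
proof -
  have "\<not> V \<subseteq> set xs"
    using assms card_mono[of "set xs" V] card_length[of xs] by (meson finite_set leD order_trans)
  then show ?thesis by auto
qed

lemma list_card_le:
  assumes "finite V" "set xs \<subseteq> V" "distinct xs"
  shows "length xs \<le> card V"
  using assms by (metis card_mono distinct_card)

text \<open>
  For two matchings there is no obstruction. On at least four vertices, \<open>u\<close> has at most two
  neighbours, so some pair can be contracted; on two vertices the only matching, combined with
  itself, counts as a cycle of length two.
\<close>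
lemma hamiltonian_mate_two:
  assumes "finite V" "matching_on V a" "matching_on V c"
  shows "hamiltonian_mate V {a, c}"
  using assms
proof (induction "card V" arbitrary: V a c rule: less_induct)
  case less
  note D = matching_onD[OF less.prems(2)] matching_onD[OF less.prems(3)]
  show ?case
  proof (cases "card V \<ge> 4")
    case True
    then obtain u where u: "u \<in> V" by fastforce
    obtain v where v: "v \<in> V" "v \<notin> set [u, a u, c u]"
      using ex_not_in_list[OF less.prems(1), of "[u, a u, c u]"] True by auto
    have "hamiltonian_mate (V - {u, v}) {contract u v a, contract u v c}"
    proof (rule less.hyps)
      show "card (V - {u, v}) < card V"
        using u less.prems(1) by (intro psubset_card_mono) auto
    qed (use less.prems u v in \<open>auto intro!: matching_on_contract\<close>)
    then show ?thesis
      using hamiltonian_mate_uncontract[of u V v "{a, c}"] less.prems u v by auto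
  next
    case False
    have small: "\<not> distinct [p, q, r, s]" if "{p, q, r, s} \<subseteq> V" for p q r s
      using list_card_le[OF less.prems(1), of "[p, q, r, s]"] that False by auto
    have eq: "c x = a x" if x: "x \<in> V" for x
    proof (rule ccontr)
      assume "c x \<noteq> a x"
      moreover have "c (a x) \<noteq> x" "c (a x) \<noteq> c x" using calculation D x by metis+
      ultimately show False using small[of x "a x" "c x" "c (a x)"] D x by auto
    qed
    have "y = x \<or> y = a x" if "x \<in> V" "y \<in> V" for x y
      using small[of x "a x" y "a y"] D that by auto metis+
    then have "hamiltonian V a a" unfolding hamiltonian_def by blast
    then have "hamiltonian_mate V {a}" using less.prems unfolding hamiltonian_mate_def by auto
    then show ?thesis by (rule hamiltonian_mate_cong) (use eq in auto)
  qed
qed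

text \<open>
  Let \<open>e = {x, y}\<close> be the edge that lies in \<open>a\<close> and \<open>b\<close> but not in \<open>c\<close>. Contracting a pair away
  from \<open>e\<close> keeps \<open>e\<close> in \<open>a\<close> and \<open>b\<close>, and puts it into \<open>c\<close> only if the pair is the one formed by
  the partners of \<open>x\<close> and \<open>y\<close> in \<open>c\<close>. Once at most five vertices are left, \<open>a\<close> and \<open>b\<close> coincide,
  because outside \<open>e\<close> there is room for one further edge only, and two matchings always have a
  common partner.
\<close>
lemma hamiltonian_mate_if_doubly_covered_edge:
  assumes "finite V" "matching_on V a" "matching_on V b" "matching_on V c"
    and "x \<in> V" "a x = b x" "c x \<noteq> a x"
  shows "hamiltonian_mate V {a, b, c}"
  using assms
proof (induction "card V" arbitrary: V a b c rule: less_induct)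
  case less
  note D = matching_onD[OF less.prems(2)] matching_onD[OF less.prems(3)] matching_onD[OF less.prems(4)]
  note x = less.prems(5-7)
  have agree: "hamiltonian_mate W {a, b, c}"
    if W: "finite W" "card W \<le> 5" "x \<in> W" "a x = b x"
      and m: "matching_on W a" "matching_on W b" "matching_on W c" for W and a b c :: "'a \<Rightarrow> 'a"
  proof -
    note E = matching_onD[OF m(1)] matching_onD[OF m(2)]
    have "a z = b z" if z: "z \<in> W" for z
    proof (rule ccontr)
      assume n: "a z \<noteq> b z"
      have "b (a z) \<noteq> z" "b (a z) \<noteq> b z" using n E z by metis+
      moreover have "z \<noteq> x" "z \<noteq> a x" "a z \<noteq> x" "a z \<noteq> a x" "b z \<noteq> x" "b z \<noteq> a x"
        using n E z W(3,4) by metis+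
      moreover have "b (a z) \<noteq> x" "b (a z) \<noteq> a x"
        using E z W(3,4) calculation by metis+
      ultimately have "distinct [x, a x, z, a z, b z, b (a z)]" using E z W(3) n by auto
      moreover have "set [x, a x, z, a z, b z, b (a z)] \<subseteq> W" using E z W(3) by auto
      ultimately show False using list_card_le[OF W(1)] W(2) by fastforce
    qed
    then show ?thesis
      using hamiltonian_mate_cong[OF hamiltonian_mate_two[OF W(1) m(1,3)], of "{a, b, c}"] by auto
  qed
  show ?case
  proof (cases "card V \<le> 5")
    case True
    then show ?thesis using agree less.prems by auto
  next
    case False
    define y p q where "y = a x" and "p = c x" and "q = c y"
    have yx: "y \<in> V" "y \<noteq> x" "b x = y" "a y = x" "b y = x" using D x y_def by metis+
    have p: "p \<in> V" "p \<noteq> x" "p \<noteq> y" "c p = x" using D x y_def p_def by metis+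
    \<comment> \<open>The pair to contract is \<open>{p, v}\<close>; the neighbour of \<open>p\<close> in \<open>c\<close> is \<open>x\<close>. The choice \<open>v = q\<close>
      would put \<open>e\<close> into \<open>c\<close> as well. With six or seven vertices it may be unavoidable, but then it
      is harmless, since the contracted \<open>a\<close> and \<open>b\<close> coincide anyway.\<close>
    have "\<exists>v\<in>V. v \<notin> {x, y, p, a p, b p} \<and> (card V \<ge> 8 \<longrightarrow> v \<noteq> q)"
    proof (cases "card V \<ge> 8")
      case True
      then show ?thesis using ex_not_in_list[OF less.prems(1), of "[x, y, p, a p, b p, q]"] by auto
    next
      case 2: False
      then show ?thesis
        using ex_not_in_list[OF less.prems(1), of "[x, y, p, a p, b p]"] False by auto
    qed
    then obtain v where v: "v \<in> V" "v \<notin> {x, y, p, a p, b p}" "card V \<ge> 8 \<longrightarrow> v \<noteq> q" by blast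
    let ?W = "V - {p, v}"
    let ?a = "contract p v a" and ?b = "contract p v b" and ?c = "contract p v c"
    have m: "matching_on ?W ?a" "matching_on ?W ?b" "matching_on ?W ?c"
      using less.prems p v by (auto intro!: matching_on_contract)
    have card: "card ?W = card V - 2" using p(1) v less.prems(1) by (subst card_Diff_subset) auto
    have W: "finite ?W" "x \<in> ?W" using less.prems p v by auto
    have ab: "?a x = y" "?b x = y" using yx p v y_def by (auto simp: contract_def)
    have "hamiltonian_mate ?W {?a, ?b, ?c}"
    proof (cases "card V \<ge> 8")
      case True
      have "?c x = c v" using p_def p v by (auto simp: contract_def)
      moreover have "c v \<noteq> y" using True v D(12)[of v] q_def by auto
      ultimately have "?c x \<noteq> ?a x" using ab by simp
      then show ?thesis using less.hyps[OF _ W(1) m W(2)] ab card True by simp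
    next
      case False
      then show ?thesis using agree[OF W(1) _ W(2) _ m] ab card by auto
    qed
    then show ?thesis
      using hamiltonian_mate_uncontract[of p V v "{a, b, c}"] less.prems p v by auto
  qed
qed

text \<open>
  On the path \<open>u\<close>, \<open>x\<close>, \<open>y\<close>, \<open>v\<close> with edges in \<open>a\<close>, \<open>b\<close>, \<open>a\<close>, contracting the ends makes
  \<open>{x, y}\<close> an edge of \<open>a\<close> while it stays an edge of \<open>b\<close>. The last two hypotheses, together with
  \<open>c u \<noteq> x\<close>, keep it out of \<open>c\<close>.
\<close>
lemma hamiltonian_mate_if_path:
  assumes V: "finite V" and m: "matching_on V a" "matching_on V b" "matching_on V c"
    and u: "u \<in> V" and path: "x = a u" "y = b x" "v = a y"
    and "y \<noteq> u" "b u \<noteq> v" "c u \<noteq> v" "c u \<noteq> x" "c x \<noteq> y" "\<not> (c u = y \<and> c v = x)"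
  shows "hamiltonian_mate V {a, b, c}"
proof -
  note D = matching_onD[OF m(1)] matching_onD[OF m(2)] matching_onD[OF m(3)]
  let ?a = "contract u v a" and ?b = "contract u v b" and ?c = "contract u v c"
  let ?W = "V - {u, v}"
  have i: "x \<in> V" "y \<in> V" "v \<in> V" using D u path by metis+
  have n: "x \<noteq> u" "y \<noteq> x" "v \<noteq> y" "v \<noteq> u" "v \<noteq> x" "a u \<noteq> v"
    using D u path i assms(9) by metis+
  have m': "matching_on ?W ?a" "matching_on ?W ?b" "matching_on ?W ?c"
    using m u i assms(9-14) n by (auto intro!: matching_on_contract)
  have "?a x = y" using D u path i by (auto simp: contract_def)
  moreover have "?b x = y" using path n assms(9) by (auto simp: contract_def)
  moreover have "?c x \<noteq> y"
    using D(12) u i assms(9-14) unfolding contract_def by metis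
  ultimately have "hamiltonian_mate ?W {?a, ?b, ?c}"
    using hamiltonian_mate_if_doubly_covered_edge[OF _ m', of x] V i n by auto
  then show ?thesis
    using hamiltonian_mate_uncontract[of u V v "{a, b, c}"] m u i n assms(9-14) by auto
qed

definition edge_disjoint :: "'a set \<Rightarrow> ('a \<Rightarrow> 'a) \<Rightarrow> ('a \<Rightarrow> 'a) \<Rightarrow> ('a \<Rightarrow> 'a) \<Rightarrow> bool" where
  "edge_disjoint V a b c \<longleftrightarrow> (\<forall>x\<in>V. a x \<noteq> b x \<and> a x \<noteq> c x \<and> b x \<noteq> c x)"

text \<open>
  Here \<open>T\<close> is a union of components. Contracting \<open>u \<in> T\<close> with \<open>v \<notin> T\<close> leaves only three edges
  between \<open>T - {u}\<close> and the rest, one in each matching. The path from \<open>a u\<close> with edges in \<open>a\<close>,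
  \<open>b\<close>, \<open>a\<close> crosses over by the first of them and then stays outside \<open>T\<close>, whereas the other two
  neighbours of \<open>a u\<close> are in \<open>T\<close>; so the path satisfies the conditions of
  \<open>hamiltonian_mate_if_path\<close>.
\<close>
lemma hamiltonian_mate_if_disconnected:
  assumes V: "finite V" and m: "matching_on V a" "matching_on V b" "matching_on V c"
    and disj: "edge_disjoint V a b c"
    and T: "T \<subseteq> V" "T \<noteq> {}" "T \<noteq> V" "a ` T \<subseteq> T" "b ` T \<subseteq> T" "c ` T \<subseteq> T"
  shows "hamiltonian_mate V {a, b, c}"
proof -
  note D = matching_onD[OF m(1)] matching_onD[OF m(2)] matching_onD[OF m(3)]
  obtain u v where uv: "u \<in> T" "v \<in> V" "v \<notin> T" using T by blast
  have u: "u \<in> V" "u \<noteq> v" using uv T by auto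
  have cl: "a z \<in> T" "b z \<in> T" "c z \<in> T" if "z \<in> T" for z using T that by auto
  have co: "a z \<notin> T" "b z \<notin> T" "c z \<notin> T" if "z \<in> V" "z \<notin> T" for z
    using cl D that by metis+
  have dj: "a z \<noteq> b z" "a z \<noteq> c z" "b z \<noteq> c z" if "z \<in> V" for z
    using disj that unfolding edge_disjoint_def by auto
  let ?a = "contract u v a" and ?b = "contract u v b" and ?c = "contract u v c"
  let ?W = "V - {u, v}"
  have nonadj: "a u \<noteq> v" "b u \<noteq> v" "c u \<noteq> v" using cl uv by auto
  have m': "matching_on ?W ?a" "matching_on ?W ?b" "matching_on ?W ?c"
    using m u uv nonadj by (auto intro!: matching_on_contract)
  define x y w where "x = a v" and "y = b x" and "w = a y"
  have x: "x \<in> V" "x \<notin> T" "x \<noteq> v" using D uv co x_def by auto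
  have y: "y \<in> V" "y \<notin> T" "y \<noteq> v" "y \<noteq> x"
    using D(8)[of x] D(5,6,7)[of x] x co y_def dj(1)[of v] x_def uv D by metis+
  have w: "w \<in> V" "w \<notin> T" "w \<noteq> v" using D y co w_def x_def uv by metis+
  have au: "a u \<in> V" "a u \<in> T" "a u \<noteq> u" using D u cl uv by auto
  have "?a (a u) = x" using D u x_def by (auto simp: contract_def)
  moreover have "?b x = y" using y uv y_def by (auto simp: contract_def)
  moreover have "?a y = w" using w uv w_def by (auto simp: contract_def)
  moreover have "?b (a u) = b (a u)" "?c (a u) = c (a u)"
    using D u dj[of u] au cl uv unfolding contract_def by metis+
  moreover have "?c x = c x"
    using dj(2)[of v] x uv D(12)[of x] co(3)[of x] x_def by (auto simp: contract_def)
  moreover have "c x \<noteq> y" using dj x y_def by metis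
  moreover have "b (a u) \<in> T" "c (a u) \<in> T" using cl uv by auto
  moreover have "finite ?W" "a u \<in> ?W" using V au nonadj(1) by auto
  ultimately have "hamiltonian_mate ?W {?a, ?b, ?c}"
    using hamiltonian_mate_if_path[OF _ m', of "a u" x y w] au x y w by metis
  then show ?thesis
    using hamiltonian_mate_uncontract[of u V v "{a, b, c}"] m u uv nonadj by auto
qed

text \<open>
  The vertices \<open>u\<close>, \<open>p = a u\<close>, \<open>z = a (b u)\<close>, \<open>q = b u\<close> form a cycle alternating between \<open>a\<close> and
  \<open>b\<close>, with diagonals \<open>{u, z}\<close> and \<open>{p, q}\<close>. If neither is in \<open>c\<close>, contracting \<open>u\<close> with \<open>z\<close> puts
  \<open>{p, q}\<close> into both \<open>a\<close> and \<open>b\<close>. If both are in \<open>c\<close>, the cycle spans a component \<open>K\<^sub>4\<close>. If just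
  one is in \<open>c\<close>, a suitable path leaves the cycle through the end of the other one.
\<close>
lemma hamiltonian_mate_if_4_cycle:
  assumes V: "finite V" "card V \<ge> 7"
    and m: "matching_on V a" "matching_on V b" "matching_on V c"
    and disj: "edge_disjoint V a b c"
    and u: "u \<in> V" "a (b u) = b (a u)"
  shows "hamiltonian_mate V {a, b, c}"
proof -
  note D = matching_onD[OF m(1)] matching_onD[OF m(2)] matching_onD[OF m(3)]
  have dj: "a z \<noteq> b z" "a z \<noteq> c z" "b z \<noteq> c z" if "z \<in> V" for z
    using disj that unfolding edge_disjoint_def by auto
  have one_diagonal: "hamiltonian_mate V {a, b, c}"
    if u: "u \<in> V" "a (b u) = b (a u)" and c: "c u = a (b u)" "c (a u) \<noteq> b u" for u
  proof -
    define p q z where "p = a u" and "q = b u" and "z = a q"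
    have i: "p \<in> V" "q \<in> V" "z \<in> V" using D u p_def q_def z_def by metis+
    have e: "a u = p" "a p = u" "b u = q" "b q = u" "a q = z" "a z = q" "b p = z" "b z = p"
      "c u = z" "c z = u"
      using D u i c(1) p_def q_def z_def by metis+
    \<comment> \<open>The \<open>c\<close>-edge at \<open>p\<close> leaves the 4-cycle. The path has edges in \<open>c\<close>, \<open>a\<close>, \<open>c\<close>, and the
      neighbours of \<open>p\<close> other than \<open>x\<close> are \<open>u\<close> and \<open>z\<close>. These are joined to each other by \<open>c\<close>
      and to \<open>p\<close> and \<open>q\<close> by \<open>a\<close>, so the end \<open>v\<close> of the path is neither of them.\<close>
    define x y v where "x = c p" and "y = a x" and "v = c y"
    have i': "x \<in> V" "y \<in> V" "v \<in> V" using D i x_def y_def v_def by metis+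
    have x: "x \<noteq> q" "x \<noteq> p" "x \<noteq> u" "x \<noteq> z" "c x = p"
      using c(2) e x_def D i u q_def p_def dj by metis+
    have y: "y \<noteq> p" "y \<noteq> z" "y \<noteq> u" "y \<noteq> x" using x e y_def i' D by metis+
    have v: "v \<noteq> z" "v \<noteq> u" using y v_def e i' D u i by metis+
    have "hamiltonian_mate V {c, a, b}"
      using hamiltonian_mate_if_path[OF V(1) m(3,1,2) i(1) x_def y_def v_def] e x y v dj i' y_def
      by metis
    then show ?thesis by (simp add: insert_commute)
  qed
  define p q z where "p = a u" and "q = b u" and "z = a q"
  have i: "p \<in> V" "q \<in> V" "z \<in> V" using D u p_def q_def z_def by metis+
  have e: "a u = p" "a p = u" "b u = q" "b q = u" "a q = z" "a z = q" "b p = z" "b z = p"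
    using D u i p_def q_def z_def by metis+
  consider "c u \<noteq> z" "c p \<noteq> q" | "c u = z" "c p \<noteq> q" | "c u \<noteq> z" "c p = q" | "c u = z" "c p = q"
    by blast
  then show ?thesis
  proof cases
    case 1
    let ?a = "contract u z a" and ?b = "contract u z b" and ?c = "contract u z c"
    let ?W = "V - {u, z}"
    have n: "p \<noteq> u" "p \<noteq> z" "q \<noteq> z" "q \<noteq> u" "u \<noteq> z" using e D u i dj by metis+
    have m': "matching_on ?W ?a" "matching_on ?W ?b" "matching_on ?W ?c"
      using m u i e n 1 by (auto intro!: matching_on_contract)
    have "?a p = q" "?b p = q" using e n by (auto simp: contract_def)
    moreover have "?c p \<noteq> q" using 1 e D i u dj unfolding contract_def by metis
    ultimately have "hamiltonian_mate ?W {?a, ?b, ?c}"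
      using hamiltonian_mate_if_doubly_covered_edge[OF _ m', of p] V i n by auto
    then show ?thesis
      using hamiltonian_mate_uncontract[of u V z "{a, b, c}"] m u i n e 1 by auto
  next
    case 2
    then show ?thesis using one_diagonal[OF u] e by auto
  next
    case 3
    then show ?thesis using one_diagonal[of p] i e by auto
  next
    case 4
    let ?T = "{u, p, q, z}"
    have "c z = u" "c q = p" using 4 D u i by metis+
    moreover have "?T \<noteq> V"
      using V(2) card_length[of "[u, p, q, z]"] by auto
    ultimately show ?thesis
      using hamiltonian_mate_if_disconnected[OF V(1) m disj, of ?T] u i e 4 by auto
  qed
qed

lemma edge_disjoint_commute:
  "edge_disjoint V a b c \<Longrightarrow> edge_disjoint V b a c"
  "edge_disjoint V a b c \<Longrightarrow> edge_disjoint V a c b"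
  unfolding edge_disjoint_def by metis+

text \<open>
  Suppose that there is no common partner. By \<open>hamiltonian_mate_if_4_cycle\<close> no two of the
  matchings form a 4-cycle together. So the only way in which a path with edges in \<open>a\<close>, \<open>b\<close>, \<open>a\<close> can escape
  \<open>hamiltonian_mate_if_path\<close> is that its ends are joined by \<open>c\<close>. This gives \<open>a b a = c = b a b\<close> as
  maps on \<open>V\<close>; these are the relations of the three transpositions of the symmetric group on three
  letters, so the orbit of a vertex has at most six elements (it spans a \<open>K\<^sub>3\<^sub>,\<^sub>3\<close>), and the
  graph is disconnected.
\<close>
lemma hamiltonian_mate_if_edge_disjoint:
  assumes V: "finite V" "card V \<ge> 7"
    and m: "matching_on V a" "matching_on V b" "matching_on V c"
    and disj: "edge_disjoint V a b c"
  shows "hamiltonian_mate V {a, b, c}"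
proof (rule ccontr)
  assume no: "\<not> ?thesis"
  have word: "a' (b' (a' u)) = c' u"
    if m': "matching_on V a'" "matching_on V b'" "matching_on V c'"
      and disj': "edge_disjoint V a' b' c'" and eq: "{a', b', c'} = {a, b, c}" and u: "u \<in> V"
    for a' b' c' u
  proof (rule ccontr)
    assume c: "a' (b' (a' u)) \<noteq> c' u"
    note D = matching_onD[OF m'(1)] matching_onD[OF m'(2)] matching_onD[OF m'(3)]
    have dj: "a' z \<noteq> b' z" "a' z \<noteq> c' z" "b' z \<noteq> c' z" if "z \<in> V" for z
      using disj' that unfolding edge_disjoint_def by auto
    have no': "\<not> hamiltonian_mate V {a', b', c'}" "\<not> hamiltonian_mate V {a', c', b'}"
      using no eq by (simp_all add: insert_commute)
    have ab: "a' (b' u) \<noteq> b' (a' u)"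
      using hamiltonian_mate_if_4_cycle[OF V m' disj'] no' u by blast
    have ac: "a' (c' u) \<noteq> c' (a' u)"
      using hamiltonian_mate_if_4_cycle[OF V m'(1,3,2) edge_disjoint_commute(2)[OF disj']] no' u
      by blast
    define x y v where "x = a' u" and "y = b' x" and "v = a' y"
    have i: "x \<in> V" "y \<in> V" "v \<in> V" using D u x_def y_def v_def by metis+
    have "y \<noteq> u" using dj D u x_def y_def i by metis
    moreover have "b' u \<noteq> v" using ab D u x_def y_def v_def i by metis
    moreover have "c' u \<noteq> v" using c x_def y_def v_def by metis
    moreover have "\<not> (c' u = y \<and> c' v = x)" using ac D u x_def y_def v_def i by metis
    ultimately have "hamiltonian_mate V {a', b', c'}"
      using hamiltonian_mate_if_path[OF V(1) m' u x_def y_def v_def] dj x_def y_def u i by metis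
    then show False using no' by simp
  qed
  note D = matching_onD[OF m(1)] matching_onD[OF m(2)] matching_onD[OF m(3)]
  have aba: "a (b (a u)) = c u" if "u \<in> V" for u
    using word[OF m disj refl that] .
  have bab: "b (a (b u)) = c u" if "u \<in> V" for u
    using word[OF m(2,1,3) edge_disjoint_commute(1)[OF disj] _ that] by (simp add: insert_commute)
  obtain u where u: "u \<in> V" using V(2) by fastforce
  let ?xs = "[u, a u, b u, c u, a (b u), b (a u)]"
  have T: "set ?xs \<subseteq> V" using D u by auto
  have "set ?xs \<noteq> V" using V(2) card_length[of ?xs] by auto
  moreover have "a (c u) = b (a u)" "b (c u) = a (b u)" using aba bab D u by metis+
  moreover have "c (a u) = a (b u)" "c (b u) = b (a u)" using aba bab D u by metis+
  moreover have "c (a (b u)) = a u" "c (b (a u)) = b u"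
    using D(12)[of "a u"] D(12)[of "b u"] calculation D u by metis+
  ultimately show False
    using hamiltonian_mate_if_disconnected[OF V(1) m disj T] no D u aba bab by auto
qed

lemma hamiltonian_mate_three:
  assumes V: "finite V" "card V \<ge> 7"
    and m: "matching_on V a" "matching_on V b" "matching_on V c"
    and no_common: "\<And>x. x \<in> V \<Longrightarrow> \<not> (a x = b x \<and> a x = c x)"
  shows "hamiltonian_mate V {a, b, c}"
proof (cases "edge_disjoint V a b c")
  case True
  then show ?thesis using hamiltonian_mate_if_edge_disjoint V m by blast
next
  case False
  then obtain x where x: "x \<in> V" "a x = b x \<or> a x = c x \<or> b x = c x"
    unfolding edge_disjoint_def by blast
  then consider "a x = b x" "c x \<noteq> a x" | "a x = c x" "b x \<noteq> a x" | "b x = c x" "a x \<noteq> b x"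
    using no_common by metis
  then show ?thesis
    using hamiltonian_mate_if_doubly_covered_edge[OF V(1) m x(1)]
      hamiltonian_mate_if_doubly_covered_edge[OF V(1) m(1,3,2) x(1)]
      hamiltonian_mate_if_doubly_covered_edge[OF V(1) m(2,3,1) x(1)]
    by cases (simp_all add: insert_commute)
qed

section \<open>Perfect matchings and their mates\<close>

definition mate :: "'v::finite set set \<Rightarrow> 'v \<Rightarrow> 'v" where
  "mate M v = (THE w. {v, w} \<in> M)"

lemma mate_iff:
  assumes "perfect_matching M"
  shows "{v, w} \<in> M \<longleftrightarrow> w = mate M v"
proof -
  obtain e where e: "e \<in> M" "v \<in> e" "\<And>e'. e' \<in> M \<Longrightarrow> v \<in> e' \<Longrightarrow> e' = e"
    using assms unfolding perfect_matching_def by metis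
  have "card e = 2" using e(1) assms unfolding perfect_matching_def complete_edges_def by auto
  then obtain w0 where w0: "e = {v, w0}" "w0 \<noteq> v"
    using e(2) by (auto simp: card_2_iff)
  have uniq: "w = w0" if "{v, w} \<in> M" for w
  proof -
    have "{v, w} = {v, w0}" using e(3)[OF that] w0 by simp
    then show ?thesis by (simp add: doubleton_eq_iff) metis
  qed
  then have "mate M v = w0"
    unfolding mate_def by (rule the_equality[rotated]) (use e(1) w0(1) in blast)+
  then show ?thesis using uniq e(1) w0(1) by metis
qed

lemma matching_on_mate:
  assumes "perfect_matching M"
  shows "matching_on UNIV (mate M)"
proof -
  have "mate M x \<noteq> x" for x
  proof
    assume "mate M x = x"
    then have "{x} \<in> M" using mate_iff[OF assms, of x x] by simp
    then have "card {x} = 2"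
      using assms unfolding perfect_matching_def complete_edges_def by blast
    then show False by simp
  qed
  moreover have "mate M (mate M x) = x" for x
    using mate_iff[OF assms] by (metis insert_commute)
  ultimately show ?thesis unfolding matching_on_def by auto
qed

lemma perfect_matching_eq_mate:
  assumes "perfect_matching M"
  shows "M = range (\<lambda>v. {v, mate M v})"
proof
  show "range (\<lambda>v. {v, mate M v}) \<subseteq> M" using mate_iff[OF assms] by auto
  show "M \<subseteq> range (\<lambda>v. {v, mate M v})"
  proof
    fix e assume e: "e \<in> M"
    then have "card e = 2" using assms unfolding perfect_matching_def complete_edges_def by auto
    then obtain v w where "e = {v, w}" by (auto simp: card_2_iff)
    then show "e \<in> range (\<lambda>v. {v, mate M v})" using mate_iff[OF assms] e by auto
  qed
qed

lemma perfect_matching_of_involution: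
  fixes g :: "'v::finite \<Rightarrow> 'v"
  assumes "matching_on UNIV g"
  shows "perfect_matching (range (\<lambda>v. {v, g v}))" and "mate (range (\<lambda>v. {v, g v})) = g"
proof -
  note D = matching_onD[OF assms UNIV_I]
  let ?M = "range (\<lambda>v. {v, g v})"
  show pm: "perfect_matching ?M"
    unfolding perfect_matching_def complete_edges_def
  proof (intro conjI allI)
    show "?M \<subseteq> {e. card e = 2}" using D(3) by auto
    fix v
    have "e = {v, g v}" if e: "e \<in> ?M" "v \<in> e" for e
    proof -
      obtain w where "e = {w, g w}" using e(1) by auto
      then show ?thesis using e(2) D(4)[of w] by auto
    qed
    then show "\<exists>!e. e \<in> ?M \<and> v \<in> e" by (intro ex1I[of _ "{v, g v}"]) auto
  qed
  show "mate ?M = g"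
  proof
    fix v
    have "{v, g v} \<in> ?M" by blast
    then show "mate ?M v = g v" using mate_iff[OF pm, of v "g v"] by metis
  qed
qed

section \<open>A single alternating cycle gives an edge of the polytope\<close>

text \<open>
  Two matchings differ in a single alternating cycle exactly if they differ somewhere and a set that
  is a union of components of \<open>f \<union> g\<close> never separates two places at which they differ.
\<close>
definition alternating_cycle :: "('a \<Rightarrow> 'a) \<Rightarrow> ('a \<Rightarrow> 'a) \<Rightarrow> bool" where
  "alternating_cycle f g \<longleftrightarrow> f \<noteq> g \<and>
     (\<forall>S. f ` S \<subseteq> S \<longrightarrow> g ` S \<subseteq> S \<longrightarrow> (\<forall>x\<in>S. f x = g x) \<or> (\<forall>x. x \<notin> S \<longrightarrow> f x = g x))"

text \<open>
  Where \<open>h\<close> follows \<open>f\<close> it has to do so along the whole alternating cycle: the set on which \<open>h\<close>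
  agrees with \<open>f\<close> is closed under both \<open>f\<close> and \<open>g\<close>.
\<close>
lemma involution_within_alternating_cycle:
  assumes ac: "alternating_cycle f g"
    and m: "matching_on UNIV f" "matching_on UNIV g" "matching_on UNIV h"
    and sub: "\<And>x. h x = f x \<or> h x = g x"
  shows "h = f \<or> h = g"
proof -
  note D = matching_onD[OF m(1) UNIV_I] matching_onD[OF m(2) UNIV_I] matching_onD[OF m(3) UNIV_I]
  let ?S = "{x. h x = f x}"
  have "f ` ?S \<subseteq> ?S" using D by (clarsimp, metis)
  moreover have "g ` ?S \<subseteq> ?S"
  proof clarsimp
    fix x assume "h x = f x"
    then show "h (g x) = f (g x)" using D sub[of "g x"] by metis
  qed
  ultimately have "(\<forall>x\<in>?S. f x = g x) \<or> (\<forall>x. x \<notin> ?S \<longrightarrow> f x = g x)"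
    using ac unfolding alternating_cycle_def by blast
  then show ?thesis
  proof
    assume "\<forall>x\<in>?S. f x = g x"
    then have "h x = g x" for x using sub[of x] by auto
    then show ?thesis by auto
  next
    assume "\<forall>x. x \<notin> ?S \<longrightarrow> f x = g x"
    then have "h x = f x" for x using sub[of x] by auto
    then show ?thesis by auto
  qed
qed

lemma perfect_matching_within_alternating_cycle:
  assumes pm: "perfect_matching M" "perfect_matching M'" "perfect_matching N"
    and ac: "alternating_cycle (mate M) (mate M')" and sub: "N \<subseteq> M \<union> M'"
  shows "N = M \<or> N = M'"
proof -
  have "mate N x = mate M x \<or> mate N x = mate M' x" for x
    using mate_iff[OF pm(1), of x "mate N x"] mate_iff[OF pm(2), of x "mate N x"]
      mate_iff[OF pm(3), of x "mate N x"] sub by auto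
  then have "mate N = mate M \<or> mate N = mate M'"
    using involution_within_alternating_cycle[OF ac] pm matching_on_mate by metis
  then show ?thesis using perfect_matching_eq_mate pm by metis
qed

lemma adjacent_if_alternating_cycle:
  fixes M M' :: "'v::finite set set"
  assumes pm: "perfect_matching M" "perfect_matching M'"
    and ac: "alternating_cycle (mate M) (mate M')"
  shows "adjacent_matchings M M'"
proof -
  \<comment> \<open>The functional \<open>c\<close> counts the edges outside \<open>M \<union> M'\<close>, so it is nonnegative on the
    polytope, and the face on which it vanishes is the required segment.\<close>
  let ?PM = "{N::'v set set. perfect_matching N}"
  let ?P = "perfect_matching_polytope :: (real ^ 'v set) set"
  define c :: "real ^ 'v set" where "c = char_vec (- (M \<union> M'))"
  have inner: "c \<bullet> char_vec N = real (card (N - (M \<union> M')))" for N :: "'v set set"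
  proof -
    have "c \<bullet> char_vec N = (\<Sum>e\<in>UNIV. if e \<in> N - (M \<union> M') then 1 else 0)"
      unfolding inner_vec_def char_vec_def c_def by (intro sum.cong) auto
    also have "\<dots> = (\<Sum>e\<in>N - (M \<union> M'). 1)" by (subst sum.inter_restrict[symmetric]) auto
    finally show ?thesis by simp
  qed
  have ge: "0 \<le> c \<bullet> x" if "x \<in> ?P" for x
  proof -
    have "?P \<subseteq> {x. 0 \<le> c \<bullet> x}"
      unfolding perfect_matching_polytope_def
      by (rule hull_minimal) (auto simp: inner convex_halfspace_ge)
    then show ?thesis using that by auto
  qed
  let ?F = "?P \<inter> {x. c \<bullet> x = 0}"
  have face: "?F face_of ?P"
    by (rule face_of_Int_supporting_hyperplane_ge)
      (use ge in \<open>auto simp: perfect_matching_polytope_def convex_convex_hull\<close>)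
  have "compact (char_vec ` ?PM)" by (simp add: finite_imp_compact)
  then obtain A where A: "A \<subseteq> char_vec ` ?PM" "?F = convex hull A"
    using face face_of_convex_hull_subset unfolding perfect_matching_polytope_def by metis
  have vert: "char_vec N \<in> ?P" if "perfect_matching N" for N
    unfolding perfect_matching_polytope_def using that by (auto intro: hull_inc)
  have "A \<subseteq> {char_vec M, char_vec M'}"
  proof
    fix x assume x: "x \<in> A"
    then obtain N where N: "perfect_matching N" "x = char_vec N" using A(1) by auto
    have "x \<in> ?F" using x A(2) hull_inc by metis
    then have "card (N - (M \<union> M')) = 0" using N(2) inner[of N] by auto
    then have "N \<subseteq> M \<union> M'" by auto
    then show "x \<in> {char_vec M, char_vec M'}"
      using perfect_matching_within_alternating_cycle[OF pm N(1) ac] N(2) by auto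
  qed
  then have "?F \<subseteq> closed_segment (char_vec M) (char_vec M')"
    unfolding A(2) segment_convex_hull by (rule hull_mono)
  moreover have "closed_segment (char_vec M) (char_vec M') \<subseteq> ?F"
  proof (rule closed_segment_subset)
    show "char_vec M \<in> ?F" "char_vec M' \<in> ?F" using vert pm inner[of M] inner[of M'] by auto
    show "convex ?F" using face face_of_imp_convex by blast
  qed
  ultimately have "closed_segment (char_vec M) (char_vec M') face_of ?P" using face by auto
  moreover have "char_vec M \<noteq> char_vec M'"
  proof
    assume eq: "char_vec M = char_vec M'"
    have "e \<in> M \<longleftrightarrow> e \<in> M'" for e
      using arg_cong[OF eq, of "\<lambda>x. x $ e"] by (auto simp: char_vec_def split: if_splits)
    then have "M = M'" by auto
    then show False using ac unfolding alternating_cycle_def by simp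
  qed
  then have "aff_dim (closed_segment (char_vec M) (char_vec M')) = 1"
    by (simp add: segment_convex_hull aff_dim_convex_hull aff_dim_2)
  ultimately show ?thesis using pm unfolding adjacent_matchings_def edge_of_def by auto
qed

section \<open>Matchings that differ on few or on many vertices\<close>

text \<open>
  If the difference falls into two parts, each part contains an alternating cycle of two distinct
  matchings, which has at least the four vertices \<open>x\<close>, \<open>f x\<close>, \<open>g x\<close>, \<open>g (f x)\<close>.
\<close>
lemma alternating_cycle_if_small:
  assumes V: "finite V" "card V < 8" and m: "matching_on UNIV f" "matching_on UNIV g"
    and "f \<noteq> g" and outside: "\<And>x. x \<notin> V \<Longrightarrow> f x = g x"
  shows "alternating_cycle f g"
  unfolding alternating_cycle_def
proof (intro conjI allI impI)
  note D = matching_onD[OF m(1) UNIV_I] matching_onD[OF m(2) UNIV_I]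
  have four: "\<exists>xs. length xs = 4 \<and> distinct xs \<and> set xs \<subseteq> R \<inter> V"
    if R: "f ` R \<subseteq> R" "g ` R \<subseteq> R" and x: "x \<in> R" "f x \<noteq> g x" for R x
  proof -
    have "g (f x) \<noteq> x" using x D by metis
    moreover have "f (g x) \<noteq> x" using x D by metis
    moreover have "f (g (f x)) \<noteq> f x" using calculation(1) D by metis
    ultimately have "f y \<noteq> g y" if "y \<in> {x, f x, g x, g (f x)}" for y
      using that x D by auto
    then have "{x, f x, g x, g (f x)} \<subseteq> R \<inter> V" using R x outside by blast
    moreover have "distinct [x, f x, g x, g (f x)]" using x D by auto metis+
    ultimately show ?thesis by (intro exI[of _ "[x, f x, g x, g (f x)]"]) auto
  qed
  fix S assume S: "f ` S \<subseteq> S" "g ` S \<subseteq> S"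
  show "(\<forall>x\<in>S. f x = g x) \<or> (\<forall>x. x \<notin> S \<longrightarrow> f x = g x)"
  proof (rule ccontr)
    assume "\<not> ?thesis"
    then obtain x y where xy: "x \<in> S" "f x \<noteq> g x" "y \<in> - S" "f y \<noteq> g y" by auto
    have inv: "f z \<in> - S" "g z \<in> - S" if "z \<in> - S" for z
      using S D(4,8)[of z] that by (metis ComplD ComplI image_subset_iff)+
    obtain xs where xs: "length xs = 4" "distinct xs" "set xs \<subseteq> S \<inter> V"
      using four[OF S xy(1,2)] by blast
    obtain ys where ys: "length ys = 4" "distinct ys" "set ys \<subseteq> - S \<inter> V"
      using four[of "- S" y] inv xy by blast
    have "length (xs @ ys) \<le> card V"
      by (rule list_card_le[OF V(1)]) (use xs ys in auto)
    then show False using xs ys V(2) by simp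
  qed
qed (use assms in auto)

text \<open>
  The bound on \<open>card V\<close> excludes the Hamiltonian cycle of length two, that is, \<open>f = g\<close>.
\<close>
lemma alternating_cycle_if_hamiltonian:
  assumes V: "card V \<ge> 3" and f: "matching_on UNIV f" and ham: "hamiltonian V f g"
    and inv: "f ` V \<subseteq> V" "g ` V \<subseteq> V" and outside: "\<And>x. x \<notin> V \<Longrightarrow> g x = f x"
  shows "alternating_cycle g f"
  unfolding alternating_cycle_def
proof (intro conjI allI impI)
  show "g \<noteq> f"
  proof
    assume "g = f"
    obtain x where x: "x \<in> V" using V by fastforce
    have "f ` {x, f x} \<subseteq> {x, f x}" using matching_onD(4)[OF f UNIV_I] by simp
    moreover have "{x, f x} \<subseteq> V" using inv x by auto
    ultimately have "{x, f x} = V"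
      using ham \<open>g = f\<close> unfolding hamiltonian_def by blast
    then show False using V card_length[of "[x, f x]"] by auto
  qed
  fix S assume "g ` S \<subseteq> S" "f ` S \<subseteq> S"
  then have "f ` (S \<inter> V) \<subseteq> S \<inter> V" "g ` (S \<inter> V) \<subseteq> S \<inter> V" using inv by auto
  then have "S \<inter> V = {} \<or> S \<inter> V = V" using ham unfolding hamiltonian_def by (metis inf_le2)
  then show "(\<forall>x\<in>S. g x = f x) \<or> (\<forall>x. x \<notin> S \<longrightarrow> g x = f x)" using outside by blast
qed

theorem theorem7p4:
  fixes n :: nat and M1 M2 M3 :: "'v::finite set set"
  assumes "CARD('v) = 2 * n"
    and "perfect_matching M1" and "perfect_matching M2" and "perfect_matching M3"
    and "adjacent_matchings M1 M2"
    and "M3 \<noteq> M1" and "M3 \<noteq> M2"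
  shows "(adjacent_matchings M1 M2 \<and> adjacent_matchings M1 M3 \<and> adjacent_matchings M2 M3) \<or>
    (\<exists>M'. perfect_matching M' \<and>
       adjacent_matchings M' M1 \<and> adjacent_matchings M' M2 \<and> adjacent_matchings M' M3)"
proof -
  note pm = assms(2-4)
  define a b c where "a = mate M1" and "b = mate M2" and "c = mate M3"
  have m: "matching_on UNIV a" "matching_on UNIV b" "matching_on UNIV c"
    using pm matching_on_mate a_def b_def c_def by auto
  note D = matching_onD[OF m(1) UNIV_I] matching_onD[OF m(2) UNIV_I] matching_onD[OF m(3) UNIV_I]
  define V where "V = {x. \<not> (a x = b x \<and> a x = c x)}"
  have out: "a x = b x" "a x = c x" if "x \<notin> V" for x using that V_def by auto
  have inv: "a x \<in> V" "b x \<in> V" "c x \<in> V" if "x \<in> V" for x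
    using that D unfolding V_def mem_Collect_eq by metis+
  have inv': "a ` V \<subseteq> V" "b ` V \<subseteq> V" "c ` V \<subseteq> V" using inv by auto
  show ?thesis
  proof (cases "card V < 8")
    case True
    have "a \<noteq> c" "b \<noteq> c"
      using perfect_matching_eq_mate pm assms(6,7) a_def b_def c_def by metis+
    then have "alternating_cycle a c" "alternating_cycle b c"
      using alternating_cycle_if_small[of V] True m out by (metis finite)+
    then show ?thesis
      using adjacent_if_alternating_cycle pm assms(5) a_def b_def c_def by metis
  next
    case False
    have mV: "matching_on V a" "matching_on V b" "matching_on V c"
      using inv D unfolding matching_on_def by auto
    have "hamiltonian_mate V {a, b, c}"
      by (rule hamiltonian_mate_three) (use mV False V_def in auto)
    then obtain g where g: "matching_on V g" "hamiltonian V a g" "hamiltonian V b g" "hamiltonian V c g"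
      unfolding hamiltonian_mate_def by auto
    define h where "h x = (if x \<in> V then g x else a x)" for x
    have outV: "a x \<notin> V" if "x \<notin> V" for x using inv(1)[of "a x"] D that by auto
    have h: "matching_on UNIV h"
      using matching_onD[OF g(1)] D outV unfolding matching_on_def h_def by auto
    have "h ` S = g ` S" if "S \<subseteq> V" for S
      using that by (intro image_cong) (auto simp: h_def)
    then have ham: "hamiltonian V a h" "hamiltonian V b h" "hamiltonian V c h"
      using g(2-4) unfolding hamiltonian_def by auto
    have hV: "h ` V \<subseteq> V" using matching_onD(1)[OF g(1)] by (auto simp: h_def)
    have hout: "h x = a x" "h x = b x" "h x = c x" if "x \<notin> V" for x
      using that out[of x] by (auto simp: h_def)
    have "card V \<ge> 3" using False by simp
    then have "alternating_cycle h a" "alternating_cycle h b" "alternating_cycle h c"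
      using alternating_cycle_if_hamiltonian m ham inv' hV hout by metis+
    then show ?thesis
      using adjacent_if_alternating_cycle pm perfect_matching_of_involution[OF h]
        a_def b_def c_def by metis
  qed
qed

end
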